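(* Let $\mathcal A=\langle A,T,Q,\gamma,\eta,\varepsilon\rangle$ be a skew monoidal monoid. Then its module category $\mathcal A^T$, equipped with the horizontal tensor product ($x\bullet y=yQ(x)\delta$ on objects, $s\mathbin{\bar\otimes}t=y_2Q(s)\eta t$ on arrows $s:x_1\to y_1$, $t:x_2\to y_2$), is a strict monoidal category with unit object $\varepsilon$. In this category $\mu$ is the underlying object of a comonoid, with counit the arrow $\varepsilon:\mu\to\varepsilon$ and comultiplication the arrow $\delta:\mu\to\mu\bullet\mu$. The associated representable functor $$\mathcal A^T(\mu,-):\mathcal A^T\to{}_A\mathbf{Set}_A,\qquad x\mapsto \mathcal A^T(\mu,x)=xT(A),$$ where $xT(A)$ is an $A$-$A$-bimodule by $a_1\cdot t\cdot a_2:=tS(a_1)T(a_2)$, is a faithful functor and is strong monoidal with respect to the monoidal structure induced by the comonoid $\mu$, namely $$\mathcal A^T(\mu,x)\otimes_A\mathcal A^T(\mu,y)\to\mathcal A^T(\mu,x\bullet y),\quad s\otimes_A t\mapsto (s\mathbin{\bar\otimes}t)\circ\delta,\qquad A\to\mathcal A^T(\mu,\varepsilon),\quad 1_A\mapsto\varepsilon .$$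
   Context: A skew monoidal monoid $\mathcal A=\langle A,T,Q,\gamma,\eta,\varepsilon\rangle$ consists of a monoid $A$, monoid endomorphisms $T,Q:A\to A$ and elements $\gamma,\eta,\varepsilon\in A$ such that for all $a,b\in A$: $T(a)Q(b)=Q(b)T(a)$, $\gamma T^2(a)=T(a)\gamma$, $\gamma TQ(a)=QT(a)\gamma$, $\gamma Q(a)=Q^2(a)\gamma$, $\eta a=T(a)\eta$, $a\varepsilon=\varepsilon Q(a)$, $Q(\gamma)\gamma T(\gamma)=\gamma^2$, $\gamma\eta=Q(\eta)$, $\varepsilon\gamma=T(\varepsilon)$, $Q(\varepsilon)\gamma T(\eta)=1$, $\varepsilon\eta=1$. Put $\mu:=Q(\varepsilon)\gamma$, $\delta:=\gamma T(\eta)$ (then $\gamma=\mu\delta$) and $S:A\to A^{\mathrm{op}}$, $S(a):=\mu T(Q(a)\eta)$, a monoid morphism. The module category $\mathcal A^T$ is the Eilenberg–Moore category of the monad $\langle T,\mu,\eta\rangle$ on the one-object category $A$: its objects are the elements $x\in A$ with $x\mu=xT(x)$ and $x\eta=1$; its arrows $t:x\to y$ are the elements $t\in A$ with $tx=yT(t)$; composition is multiplication in $A$. ${}_A\mathbf{Set}_A$ is the monoidal category of $A$-$A$-bisets (called $A$-$A$-bimodules), i.e. sets with commuting left and right actions of the monoid $A$, with tensor product $\otimes_A$ (the quotient of the cartesian product by the equivalence relation generated by $(m\cdot a,n)\sim(m,a\cdot n)$) and unit object $A$. *)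

theory Defs
  imports Main "HOL-Library.FuncSet"
begin

section \<open>Categories, functors, strict monoidal categories, comonoids\<close>

text \<open>
  Homs are given as a family of sets that need not be disjoint (an element of a monoid can be an
  arrow between many pairs of objects). All operations on arrows therefore take the end points
  as explicit arguments: \<open>Comp C x y z g f\<close> is \<open>g \<circ> f\<close> for \<open>f : x \<rightarrow> y\<close> and \<open>g : y \<rightarrow> z\<close>, and
  \<open>tensor_arr C x1 y1 x2 y2 s t\<close> is \<open>s \<otimes> t\<close> for \<open>s : x1 \<rightarrow> y1\<close> and \<open>t : x2 \<rightarrow> y2\<close>.
\<close>

record ('o, 'm) category =
  Obj :: "'o set"
  Hom :: "'o \<Rightarrow> 'o \<Rightarrow> 'm set"
  Ident :: "'o \<Rightarrow> 'm"
  Comp :: "'o \<Rightarrow> 'o \<Rightarrow> 'o \<Rightarrow> 'm \<Rightarrow> 'm \<Rightarrow> 'm"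

locale category =
  fixes C :: "('o, 'm, 'z) category_scheme" (structure)
  assumes Ident_in_Hom: "x \<in> Obj C \<Longrightarrow> Ident C x \<in> Hom C x x"
    and Comp_in_Hom:
      "\<lbrakk>x \<in> Obj C; y \<in> Obj C; z \<in> Obj C; f \<in> Hom C x y; g \<in> Hom C y z\<rbrakk>
        \<Longrightarrow> Comp C x y z g f \<in> Hom C x z"
    and Comp_Ident_left:
      "\<lbrakk>x \<in> Obj C; y \<in> Obj C; f \<in> Hom C x y\<rbrakk> \<Longrightarrow> Comp C x y y (Ident C y) f = f"
    and Comp_Ident_right:
      "\<lbrakk>x \<in> Obj C; y \<in> Obj C; f \<in> Hom C x y\<rbrakk> \<Longrightarrow> Comp C x x y f (Ident C x) = f"
    and Comp_assoc:
      "\<lbrakk>w \<in> Obj C; x \<in> Obj C; y \<in> Obj C; z \<in> Obj C;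
        f \<in> Hom C w x; g \<in> Hom C x y; h \<in> Hom C y z\<rbrakk>
        \<Longrightarrow> Comp C w x z (Comp C x y z h g) f = Comp C w y z h (Comp C w x y g f)"

locale cat_functor =
  C: category C + D: category D
  for C :: "('o, 'm, 'z) category_scheme"
    and D :: "('p, 'n, 'w) category_scheme" +
  fixes Fo :: "'o \<Rightarrow> 'p"
    and Fa :: "'o \<Rightarrow> 'o \<Rightarrow> 'm \<Rightarrow> 'n"
  assumes Fo_in_Obj: "x \<in> Obj C \<Longrightarrow> Fo x \<in> Obj D"
    and Fa_in_Hom:
      "\<lbrakk>x \<in> Obj C; y \<in> Obj C; f \<in> Hom C x y\<rbrakk> \<Longrightarrow> Fa x y f \<in> Hom D (Fo x) (Fo y)"
    and Fa_Ident: "x \<in> Obj C \<Longrightarrow> Fa x x (Ident C x) = Ident D (Fo x)"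
    and Fa_Comp:
      "\<lbrakk>x \<in> Obj C; y \<in> Obj C; z \<in> Obj C; f \<in> Hom C x y; g \<in> Hom C y z\<rbrakk>
        \<Longrightarrow> Fa x z (Comp C x y z g f) = Comp D (Fo x) (Fo y) (Fo z) (Fa y z g) (Fa x y f)"

locale faithful_functor = cat_functor +
  assumes faithful: "\<lbrakk>x \<in> Obj C; y \<in> Obj C\<rbrakk> \<Longrightarrow> inj_on (Fa x y) (Hom C x y)"

record ('o, 'm) monoidal = "('o, 'm) category" +
  tensor_obj :: "'o \<Rightarrow> 'o \<Rightarrow> 'o" (infixl "\<bullet>\<index>" 70)
  tensor_arr :: "'o \<Rightarrow> 'o \<Rightarrow> 'o \<Rightarrow> 'o \<Rightarrow> 'm \<Rightarrow> 'm \<Rightarrow> 'm"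
  unit_obj :: "'o"

locale strict_monoidal_category = category C
  for C :: "('o, 'm, 'z) monoidal_scheme" (structure) +
  assumes unit_in_Obj: "unit_obj C \<in> Obj C"
    and tensor_in_Obj: "\<lbrakk>x \<in> Obj C; y \<in> Obj C\<rbrakk> \<Longrightarrow> x \<bullet> y \<in> Obj C"
    and tensor_in_Hom:
      "\<lbrakk>x1 \<in> Obj C; y1 \<in> Obj C; x2 \<in> Obj C; y2 \<in> Obj C; s \<in> Hom C x1 y1; t \<in> Hom C x2 y2\<rbrakk>
        \<Longrightarrow> tensor_arr C x1 y1 x2 y2 s t \<in> Hom C (x1 \<bullet> x2) (y1 \<bullet> y2)"
    and tensor_Ident:
      "\<lbrakk>x \<in> Obj C; y \<in> Obj C\<rbrakk>
        \<Longrightarrow> tensor_arr C x x y y (Ident C x) (Ident C y) = Ident C (x \<bullet> y)"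
    and tensor_Comp:
      "\<lbrakk>x1 \<in> Obj C; y1 \<in> Obj C; z1 \<in> Obj C; x2 \<in> Obj C; y2 \<in> Obj C; z2 \<in> Obj C;
        s \<in> Hom C x1 y1; s' \<in> Hom C y1 z1; t \<in> Hom C x2 y2; t' \<in> Hom C y2 z2\<rbrakk>
        \<Longrightarrow> tensor_arr C x1 z1 x2 z2 (Comp C x1 y1 z1 s' s) (Comp C x2 y2 z2 t' t)
          = Comp C (x1 \<bullet> x2) (y1 \<bullet> y2) (z1 \<bullet> z2)
              (tensor_arr C y1 z1 y2 z2 s' t') (tensor_arr C x1 y1 x2 y2 s t)"
    and tensor_obj_assoc:
      "\<lbrakk>x \<in> Obj C; y \<in> Obj C; z \<in> Obj C\<rbrakk> \<Longrightarrow> (x \<bullet> y) \<bullet> z = x \<bullet> (y \<bullet> z)"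
    and unit_tensor_obj: "x \<in> Obj C \<Longrightarrow> unit_obj C \<bullet> x = x"
    and tensor_unit_obj: "x \<in> Obj C \<Longrightarrow> x \<bullet> unit_obj C = x"
    and tensor_arr_assoc:
      "\<lbrakk>x1 \<in> Obj C; y1 \<in> Obj C; x2 \<in> Obj C; y2 \<in> Obj C; x3 \<in> Obj C; y3 \<in> Obj C;
        s \<in> Hom C x1 y1; t \<in> Hom C x2 y2; u \<in> Hom C x3 y3\<rbrakk>
        \<Longrightarrow> tensor_arr C (x1 \<bullet> x2) (y1 \<bullet> y2) x3 y3 (tensor_arr C x1 y1 x2 y2 s t) u
          = tensor_arr C x1 y1 (x2 \<bullet> x3) (y2 \<bullet> y3) s (tensor_arr C x2 y2 x3 y3 t u)"
    and unit_tensor_arr: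
      "\<lbrakk>x \<in> Obj C; y \<in> Obj C; t \<in> Hom C x y\<rbrakk>
        \<Longrightarrow> tensor_arr C (unit_obj C) (unit_obj C) x y (Ident C (unit_obj C)) t = t"
    and tensor_unit_arr:
      "\<lbrakk>x \<in> Obj C; y \<in> Obj C; t \<in> Hom C x y\<rbrakk>
        \<Longrightarrow> tensor_arr C x y (unit_obj C) (unit_obj C) t (Ident C (unit_obj C)) = t"

text \<open>
  No associativity or unit isomorphisms occur in the comonoid laws, since the ambient monoidal
  category is strict: \<open>(c \<bullet> c) \<bullet> c = c \<bullet> (c \<bullet> c)\<close> and \<open>unit \<bullet> c = c = c \<bullet> unit\<close>.
\<close>

locale comonoid = strict_monoidal_category C
  for C :: "('o, 'm, 'z) monoidal_scheme" (structure) +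
  fixes c :: 'o and counit :: 'm and comult :: 'm
  assumes c_in_Obj: "c \<in> Obj C"
    and counit_in_Hom: "counit \<in> Hom C c (unit_obj C)"
    and comult_in_Hom: "comult \<in> Hom C c (c \<bullet> c)"
    and coassoc:
      "Comp C c (c \<bullet> c) ((c \<bullet> c) \<bullet> c)
          (tensor_arr C c (c \<bullet> c) c c comult (Ident C c)) comult
        = Comp C c (c \<bullet> c) (c \<bullet> (c \<bullet> c))
            (tensor_arr C c c c (c \<bullet> c) (Ident C c) comult) comult"
    and counit_left:
      "Comp C c (c \<bullet> c) c (tensor_arr C c (unit_obj C) c c counit (Ident C c)) comult = Ident C c"
    and counit_right:
      "Comp C c (c \<bullet> c) c (tensor_arr C c c c (unit_obj C) (Ident C c) counit) comult = Ident C c"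


section \<open>Bisets\<close>

record ('a, 'e) biset =
  elems :: "'e set"
  lact :: "'a \<Rightarrow> 'e \<Rightarrow> 'e"
  ract :: "'e \<Rightarrow> 'a \<Rightarrow> 'e"

locale biset =
  fixes M :: "('a::monoid_mult, 'e) biset"
  assumes lact_in: "m \<in> elems M \<Longrightarrow> lact M a m \<in> elems M"
    and ract_in: "m \<in> elems M \<Longrightarrow> ract M m a \<in> elems M"
    and lact_one: "m \<in> elems M \<Longrightarrow> lact M 1 m = m"
    and ract_one: "m \<in> elems M \<Longrightarrow> ract M m 1 = m"
    and lact_mult: "m \<in> elems M \<Longrightarrow> lact M (a * b) m = lact M a (lact M b m)"
    and ract_mult: "m \<in> elems M \<Longrightarrow> ract M m (a * b) = ract M (ract M m a) b"
    and lact_ract: "m \<in> elems M \<Longrightarrow> ract M (lact M a m) b = lact M a (ract M m b)"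

text \<open>Maps are extensional functions, so that equality of maps is equality on the elements.\<close>

definition biset_hom ::
  "('a::monoid_mult, 'e) biset \<Rightarrow> ('a, 'f) biset \<Rightarrow> ('e \<Rightarrow> 'f) set"
  where "biset_hom M N =
    {f \<in> elems M \<rightarrow>\<^sub>E elems N.
      \<forall>m \<in> elems M. \<forall>a. f (lact M a m) = lact N a (f m) \<and> f (ract M m a) = ract N (f m) a}"

definition biset_iso ::
  "('a::monoid_mult, 'e) biset \<Rightarrow> ('a, 'f) biset \<Rightarrow> ('e \<Rightarrow> 'f) set"
  where "biset_iso M N =
    {f \<in> biset_hom M N. \<exists>g \<in> biset_hom N M.
      (\<forall>m \<in> elems M. g (f m) = m) \<and> (\<forall>n \<in> elems N. f (g n) = n)}"

definition biset_category :: "(('a::monoid_mult, 'e) biset, 'e \<Rightarrow> 'e) category"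
  where "biset_category =
    \<lparr> Obj = {M. biset M},
      Hom = biset_hom,
      Ident = (\<lambda>M. \<lambda>m\<in>elems M. m),
      Comp = (\<lambda>L M N g f. compose (elems L) g f) \<rparr>"

text \<open>
  The tensor product over the monoid changes the type of the elements, so the monoidal structure
  on bisets is given by polymorphic operations rather than by one instance of
  \<open>monoidal\<close>; the category of all bisets is split over the element types.
\<close>

definition biset_unit :: "('a::monoid_mult, 'a) biset"
  where "biset_unit = \<lparr> elems = UNIV, lact = (*), ract = (*) \<rparr>"

definition tensor_step ::
  "('a::monoid_mult, 'e) biset \<Rightarrow> ('a, 'f) biset \<Rightarrow> (('e \<times> 'f) \<times> ('e \<times> 'f)) set"
  where "tensor_step M N =
    {((ract M m a, n), (m, lact N a n)) | m a n. m \<in> elems M \<and> n \<in> elems N}"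

definition tensor_rel ::
  "('a::monoid_mult, 'e) biset \<Rightarrow> ('a, 'f) biset \<Rightarrow> (('e \<times> 'f) \<times> ('e \<times> 'f)) set"
  where "tensor_rel M N =
    (tensor_step M N \<union> (tensor_step M N)\<inverse>)\<^sup>* \<inter>
      ((elems M \<times> elems N) \<times> (elems M \<times> elems N))"

definition tens ::
  "('a::monoid_mult, 'e) biset \<Rightarrow> ('a, 'f) biset \<Rightarrow> 'e \<Rightarrow> 'f \<Rightarrow> ('e \<times> 'f) set"
  where "tens M N m n = tensor_rel M N `` {(m, n)}"

text \<open>
  \<open>tensor_lift f\<close> is the map out of a tensor product that sends the class of \<open>(m, n)\<close> to \<open>f m n\<close>.
  It is meaningful when \<open>f\<close> is balanced, i.e. constant on every class.
\<close>

definition tensor_lift :: "('e \<Rightarrow> 'f \<Rightarrow> 'g) \<Rightarrow> ('e \<times> 'f) set \<Rightarrow> 'g"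
  where "tensor_lift f X = the_elem ((\<lambda>(m, n). f m n) ` X)"

definition biset_tensor ::
  "('a::monoid_mult, 'e) biset \<Rightarrow> ('a, 'f) biset \<Rightarrow> ('a, ('e \<times> 'f) set) biset"
  (infixl "\<otimes>\<^sub>A" 70)
  where "M \<otimes>\<^sub>A N =
    \<lparr> elems = (elems M \<times> elems N) // tensor_rel M N,
      lact = (\<lambda>a. tensor_lift (\<lambda>m n. tens M N (lact M a m) n)),
      ract = (\<lambda>X a. tensor_lift (\<lambda>m n. tens M N m (ract N n a)) X) \<rparr>"

definition biset_tensor_map ::
  "('a::monoid_mult, 'e) biset \<Rightarrow> ('a, 'e') biset \<Rightarrow> ('a, 'f) biset \<Rightarrow> ('a, 'f') biset
    \<Rightarrow> ('e \<Rightarrow> 'e') \<Rightarrow> ('f \<Rightarrow> 'f') \<Rightarrow> ('e \<times> 'f) set \<Rightarrow> ('e' \<times> 'f') set"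
  where "biset_tensor_map M M' N N' f g =
    (\<lambda>X\<in>elems (M \<otimes>\<^sub>A N). tensor_lift (\<lambda>m n. tens M' N' (f m) (g n)) X)"

definition biset_assoc ::
  "('a::monoid_mult, 'e) biset \<Rightarrow> ('a, 'f) biset \<Rightarrow> ('a, 'g) biset
    \<Rightarrow> (('e \<times> 'f) set \<times> 'g) set \<Rightarrow> ('e \<times> ('f \<times> 'g) set) set"
  where "biset_assoc M N P =
    (\<lambda>X\<in>elems ((M \<otimes>\<^sub>A N) \<otimes>\<^sub>A P).
      tensor_lift (\<lambda>w p. tensor_lift (\<lambda>m n. tens M (N \<otimes>\<^sub>A P) m (tens N P n p)) w) X)"

definition biset_lunit :: "('a::monoid_mult, 'e) biset \<Rightarrow> ('a \<times> 'e) set \<Rightarrow> 'e"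
  where "biset_lunit M = (\<lambda>X\<in>elems (biset_unit \<otimes>\<^sub>A M). tensor_lift (\<lambda>a m. lact M a m) X)"

definition biset_runit :: "('a::monoid_mult, 'e) biset \<Rightarrow> ('e \<times> 'a) set \<Rightarrow> 'e"
  where "biset_runit M = (\<lambda>X\<in>elems (M \<otimes>\<^sub>A biset_unit). tensor_lift (\<lambda>m a. ract M m a) X)"


section \<open>Strong monoidal functors to bisets\<close>

text \<open>
  \<open>F2 x y : F x \<otimes>\<^sub>A F y \<rightarrow> F (x \<bullet> y)\<close> and \<open>F0 : A \<rightarrow> F unit\<close> are the structure isomorphisms. The
  source is strict, so the images under \<open>F\<close> of its coherence isomorphisms are identities and do
  not show up in the last three axioms.
\<close>

locale strong_monoidal_functor =
  C: strict_monoidal_category C +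
  cat_functor C "biset_category :: (('a, 'e) biset, 'e \<Rightarrow> 'e) category" Fo Fa
  for C :: "('o, 'm, 'z) monoidal_scheme" (structure)
    and Fo :: "'o \<Rightarrow> ('a::monoid_mult, 'e) biset"
    and Fa :: "'o \<Rightarrow> 'o \<Rightarrow> 'm \<Rightarrow> 'e \<Rightarrow> 'e" +
  fixes F2 :: "'o \<Rightarrow> 'o \<Rightarrow> ('e \<times> 'e) set \<Rightarrow> 'e"
    and F0 :: "'a \<Rightarrow> 'e"
  assumes F2_iso:
      "\<lbrakk>x \<in> Obj C; y \<in> Obj C\<rbrakk> \<Longrightarrow> F2 x y \<in> biset_iso (Fo x \<otimes>\<^sub>A Fo y) (Fo (x \<bullet> y))"
    and F0_iso: "F0 \<in> biset_iso biset_unit (Fo (unit_obj C))"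
    and F2_natural:
      "\<lbrakk>x1 \<in> Obj C; y1 \<in> Obj C; x2 \<in> Obj C; y2 \<in> Obj C;
        s \<in> Hom C x1 y1; t \<in> Hom C x2 y2\<rbrakk>
        \<Longrightarrow> \<forall>X \<in> elems (Fo x1 \<otimes>\<^sub>A Fo x2).
          Fa (x1 \<bullet> x2) (y1 \<bullet> y2) (tensor_arr C x1 y1 x2 y2 s t) (F2 x1 x2 X)
          = F2 y1 y2
              (biset_tensor_map (Fo x1) (Fo y1) (Fo x2) (Fo y2) (Fa x1 y1 s) (Fa x2 y2 t) X)"
    and F2_assoc:
      "\<lbrakk>x \<in> Obj C; y \<in> Obj C; z \<in> Obj C\<rbrakk>
        \<Longrightarrow> \<forall>X \<in> elems ((Fo x \<otimes>\<^sub>A Fo y) \<otimes>\<^sub>A Fo z).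
          F2 (x \<bullet> y) z
            (biset_tensor_map (Fo x \<otimes>\<^sub>A Fo y) (Fo (x \<bullet> y)) (Fo z) (Fo z)
              (F2 x y) (\<lambda>u\<in>elems (Fo z). u) X)
          = F2 x (y \<bullet> z)
              (biset_tensor_map (Fo x) (Fo x) (Fo y \<otimes>\<^sub>A Fo z) (Fo (y \<bullet> z))
                (\<lambda>u\<in>elems (Fo x). u) (F2 y z) (biset_assoc (Fo x) (Fo y) (Fo z) X))"
    and F2_lunit:
      "x \<in> Obj C
        \<Longrightarrow> \<forall>X \<in> elems (biset_unit \<otimes>\<^sub>A Fo x).
          F2 (unit_obj C) x
            (biset_tensor_map biset_unit (Fo (unit_obj C)) (Fo x) (Fo x)
              F0 (\<lambda>u\<in>elems (Fo x). u) X)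
          = biset_lunit (Fo x) X"
    and F2_runit:
      "x \<in> Obj C
        \<Longrightarrow> \<forall>X \<in> elems (Fo x \<otimes>\<^sub>A biset_unit).
          F2 x (unit_obj C)
            (biset_tensor_map (Fo x) (Fo x) biset_unit (Fo (unit_obj C))
              (\<lambda>u\<in>elems (Fo x). u) F0 X)
          = biset_runit (Fo x) X"


section \<open>Skew monoidal monoids and their module categories\<close>

record 'a skew_monoid =
  opT :: "'a \<Rightarrow> 'a" ("\<T>\<index>")
  opQ :: "'a \<Rightarrow> 'a" ("\<Q>\<index>")
  gam :: 'a ("\<gamma>\<index>")
  eta :: 'a ("\<eta>\<index>")
  eps :: 'a ("\<epsilon>\<index>")

locale skew_monoidal_monoid =
  fixes A :: "'a::monoid_mult skew_monoid" (structure)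
  assumes T_one: "\<T> 1 = 1"
    and T_mult: "\<T> (a * b) = \<T> a * \<T> b"
    and Q_one: "\<Q> 1 = 1"
    and Q_mult: "\<Q> (a * b) = \<Q> a * \<Q> b"
    and T_Q_commute: "\<T> a * \<Q> b = \<Q> b * \<T> a"
    and gam_TT: "\<gamma> * \<T> (\<T> a) = \<T> a * \<gamma>"
    and gam_TQ: "\<gamma> * \<T> (\<Q> a) = \<Q> (\<T> a) * \<gamma>"
    and gam_Q: "\<gamma> * \<Q> a = \<Q> (\<Q> a) * \<gamma>"
    and eta_T: "\<eta> * a = \<T> a * \<eta>"
    and eps_Q: "a * \<epsilon> = \<epsilon> * \<Q> a"
    and gam_gam: "\<Q> \<gamma> * \<gamma> * \<T> \<gamma> = \<gamma> ^ 2"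
    and gam_eta: "\<gamma> * \<eta> = \<Q> \<eta>"
    and eps_gam: "\<epsilon> * \<gamma> = \<T> \<epsilon>"
    and eps_gam_eta: "\<Q> \<epsilon> * \<gamma> * \<T> \<eta> = 1"
    and eps_eta: "\<epsilon> * \<eta> = 1"

definition mu :: "'a::monoid_mult skew_monoid \<Rightarrow> 'a" ("\<mu>\<index>")
  where "\<mu>\<^bsub>A\<^esub> = \<Q>\<^bsub>A\<^esub> \<epsilon>\<^bsub>A\<^esub> * \<gamma>\<^bsub>A\<^esub>"

definition delta :: "'a::monoid_mult skew_monoid \<Rightarrow> 'a" ("\<delta>\<index>")
  where "\<delta>\<^bsub>A\<^esub> = \<gamma>\<^bsub>A\<^esub> * \<T>\<^bsub>A\<^esub> \<eta>\<^bsub>A\<^esub>"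

definition skew_S :: "'a::monoid_mult skew_monoid \<Rightarrow> 'a \<Rightarrow> 'a" ("\<S>\<index>")
  where "\<S>\<^bsub>A\<^esub> a = \<mu>\<^bsub>A\<^esub> * \<T>\<^bsub>A\<^esub> (\<Q>\<^bsub>A\<^esub> a * \<eta>\<^bsub>A\<^esub>)"

definition module_category :: "'a::monoid_mult skew_monoid \<Rightarrow> ('a, 'a) monoidal"
  where "module_category A =
    \<lparr> Obj = {x. x * \<mu>\<^bsub>A\<^esub> = x * \<T>\<^bsub>A\<^esub> x \<and> x * \<eta>\<^bsub>A\<^esub> = 1},
      Hom = (\<lambda>x y. {t. t * x = y * \<T>\<^bsub>A\<^esub> t}),
      Ident = (\<lambda>x. 1),
      Comp = (\<lambda>x y z g f. g * f),
      tensor_obj = (\<lambda>x y. y * \<Q>\<^bsub>A\<^esub> x * \<delta>\<^bsub>A\<^esub>),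
      tensor_arr = (\<lambda>x1 y1 x2 y2 s t. y2 * \<Q>\<^bsub>A\<^esub> s * \<eta>\<^bsub>A\<^esub> * t),
      unit_obj = \<epsilon>\<^bsub>A\<^esub> \<rparr>"

definition hom_biset :: "'a::monoid_mult skew_monoid \<Rightarrow> 'a \<Rightarrow> ('a, 'a) biset"
  where "hom_biset A x =
    \<lparr> elems = Hom (module_category A) \<mu>\<^bsub>A\<^esub> x,
      lact = (\<lambda>a t. t * \<S>\<^bsub>A\<^esub> a),
      ract = (\<lambda>t a. t * \<T>\<^bsub>A\<^esub> a) \<rparr>"

definition hom_map :: "'a::monoid_mult skew_monoid \<Rightarrow> 'a \<Rightarrow> 'a \<Rightarrow> 'a \<Rightarrow> 'a \<Rightarrow> 'a"
  where "hom_map A x y t =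
    (\<lambda>s\<in>Hom (module_category A) \<mu>\<^bsub>A\<^esub> x. Comp (module_category A) \<mu>\<^bsub>A\<^esub> x y t s)"

text \<open>\<open>(s \<otimes> t) \<circ> \<delta> : \<mu> \<rightarrow> x \<bullet> y\<close> for \<open>s : \<mu> \<rightarrow> x\<close> and \<open>t : \<mu> \<rightarrow> y\<close>.\<close>

definition comonoid_pairing ::
  "'a::monoid_mult skew_monoid \<Rightarrow> 'a \<Rightarrow> 'a \<Rightarrow> 'a \<Rightarrow> 'a \<Rightarrow> 'a"
  where "comonoid_pairing A x y s t =
    (let C = module_category A; m = \<mu>\<^bsub>A\<^esub>
     in Comp C m (m \<bullet>\<^bsub>C\<^esub> m) (x \<bullet>\<^bsub>C\<^esub> y) (tensor_arr C m x m y s t) \<delta>\<^bsub>A\<^esub>)"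

definition hom_tensor_map ::
  "'a::monoid_mult skew_monoid \<Rightarrow> 'a \<Rightarrow> 'a \<Rightarrow> ('a \<times> 'a) set \<Rightarrow> 'a"
  where "hom_tensor_map A x y =
    (\<lambda>X\<in>elems (hom_biset A x \<otimes>\<^sub>A hom_biset A y). tensor_lift (comonoid_pairing A x y) X)"

text \<open>A map of bisets out of the unit is determined by the image of \<open>1\<close>, here \<open>\<epsilon>\<close>.\<close>

definition hom_unit_map :: "'a::monoid_mult skew_monoid \<Rightarrow> 'a \<Rightarrow> 'a"
  where "hom_unit_map A a = ract (hom_biset A \<epsilon>\<^bsub>A\<^esub>) \<epsilon>\<^bsub>A\<^esub> a"

end

theory Submission
  imports Defs
begin

text \<open>
  An arrow \<open>t : \<mu> \<rightarrow> x\<close> is determined by \<open>t * \<eta>\<close>, since \<open>t = x * \<T> (t * \<eta>)\<close>; hence the hom bisets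
  are free of rank one as right \<open>A\<close>-sets. Because \<open>\<mu>\<close> commutes with the image of \<open>\<Q>\<close> and
  \<open>\<mu> * \<eta> = 1\<close>, the pairing \<open>(s \<otimes> t) \<circ> \<delta>\<close> collapses to \<open>t * \<Q> s * \<delta>\<close>. It is balanced by the identity
  \<open>\<S> a * \<Q> s * \<delta> = \<Q> (s * \<T> a) * \<delta>\<close>, and the induced map on the tensor product is inverted by
  sending \<open>u\<close> to the class of \<open>(x, y * \<T> (u * \<eta>))\<close>. The coherence conditions reduce to the comonad
  laws for \<open>\<Q>\<close> with comultiplication \<open>\<delta>\<close> and counit \<open>\<epsilon>\<close>.
\<close>

section \<open>Homomorphisms of bisets\<close>

lemma biset_homI:
  assumes "\<And>m. m \<in> elems M \<Longrightarrow> f m \<in> elems N"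
    and "\<And>m. m \<notin> elems M \<Longrightarrow> f m = undefined"
    and "\<And>m a. m \<in> elems M \<Longrightarrow> f (lact M a m) = lact N a (f m)"
    and "\<And>m a. m \<in> elems M \<Longrightarrow> f (ract M m a) = ract N (f m) a"
  shows "f \<in> biset_hom M N"
proof -
  have "f \<in> elems M \<rightarrow>\<^sub>E elems N"
    using assms(1,2) by (rule PiE_I)
  then show ?thesis
    unfolding biset_hom_def by (simp add: assms(3,4))
qed

lemma
  assumes f: "f \<in> biset_hom M N"
  shows biset_hom_in: "m \<in> elems M \<Longrightarrow> f m \<in> elems N"
    and biset_hom_undefined: "m \<notin> elems M \<Longrightarrow> f m = undefined"
    and biset_hom_lact: "m \<in> elems M \<Longrightarrow> f (lact M a m) = lact N a (f m)"
    and biset_hom_ract: "m \<in> elems M \<Longrightarrow> f (ract M m a) = ract N (f m) a"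
proof -
  have "f \<in> elems M \<rightarrow>\<^sub>E elems N"
    using f by (simp add: biset_hom_def)
  then show "f m \<in> elems N" if "m \<in> elems M"
    using that by (rule PiE_mem)
  show "f m = undefined" if "m \<notin> elems M"
    using \<open>f \<in> elems M \<rightarrow>\<^sub>E elems N\<close> that by (rule PiE_arb)
  show "f (lact M a m) = lact N a (f m)" "f (ract M m a) = ract N (f m) a" if "m \<in> elems M"
    using f that unfolding biset_hom_def by blast+
qed

section \<open>Tensor products of bisets\<close>

text \<open>The reflexive transitive closure is reflexive on the whole type; intersecting it with
  the square of \<open>elems M \<times> elems N\<close> makes it a relation on that carrier.\<close>

lemma equiv_tensor_rel: "equiv (elems M \<times> elems N) (tensor_rel M N)"
proof (rule equivI)
  show "tensor_rel M N \<subseteq> (elems M \<times> elems N) \<times> (elems M \<times> elems N)"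
    by (auto simp: tensor_rel_def)
  show "refl_on (elems M \<times> elems N) (tensor_rel M N)"
    by (auto simp: tensor_rel_def refl_on_def)
  have "sym ((tensor_step M N \<union> (tensor_step M N)\<inverse>)\<^sup>*)"
    by (intro sym_rtrancl sym_Un_converse)
  then show "sym (tensor_rel M N)"
    by (auto simp: tensor_rel_def sym_def)
  show "trans (tensor_rel M N)"
    by (auto simp: tensor_rel_def trans_def intro: rtrancl_trans)
qed

lemma tens_in_elems: "m \<in> elems M \<Longrightarrow> n \<in> elems N \<Longrightarrow> tens M N m n \<in> elems (M \<otimes>\<^sub>A N)"
  by (auto simp: biset_tensor_def tens_def intro: quotientI)

lemma tens_cases:
  assumes "X \<in> elems (M \<otimes>\<^sub>A N)"
  obtains m n where "m \<in> elems M" "n \<in> elems N" "X = tens M N m n"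
  using assms by (auto simp: biset_tensor_def tens_def elim!: quotientE)

lemma tens_balanced:
  assumes "biset M" "biset N" "m \<in> elems M" "n \<in> elems N"
  shows "tens M N (ract M m a) n = tens M N m (lact N a n)"
  unfolding tens_def
proof (rule equiv_class_eq[OF equiv_tensor_rel])
  have "((ract M m a, n), (m, lact N a n)) \<in> tensor_step M N"
    using assms by (auto simp: tensor_step_def)
  then show "((ract M m a, n), (m, lact N a n)) \<in> tensor_rel M N"
    using assms by (auto simp: tensor_rel_def biset.lact_in biset.ract_in)
qed

text \<open>A balanced \<open>f\<close> does not change along a single step in either direction,
  hence not along a chain. The image of the class is therefore a singleton, and
  \<open>the_elem\<close> returns its member.\<close>

lemma tensor_lift_tens:
  assumes bal: "\<And>m a n. m \<in> elems M \<Longrightarrow> n \<in> elems N \<Longrightarrow> f (ract M m a) n = f m (lact N a n)"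
    and "m \<in> elems M" "n \<in> elems N"
  shows "tensor_lift f (tens M N m n) = f m n"
proof -
  have const: "case_prod f p = case_prod f q"
    if "(p, q) \<in> (tensor_step M N \<union> (tensor_step M N)\<inverse>)\<^sup>*" for p q
    using that by induction (auto simp: tensor_step_def bal)
  have "(m, n) \<in> tens M N m n"
    unfolding tens_def by (rule equiv_class_self[OF equiv_tensor_rel]) (simp add: assms(2,3))
  moreover have "case_prod f p = case_prod f (m, n)" if "p \<in> tens M N m n" for p
  proof -
    from that have "((m, n), p) \<in> (tensor_step M N \<union> (tensor_step M N)\<inverse>)\<^sup>*"
      by (simp add: tens_def tensor_rel_def)
    from const[OF this] show ?thesis ..
  qed
  ultimately have "case_prod f ` tens M N m n = {case_prod f (m, n)}"
    by (intro subset_antisym image_subsetI) (blast, metis empty_subsetI imageI insert_subset)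
  then show ?thesis
    by (simp add: tensor_lift_def)
qed

lemma lact_tens:
  assumes "biset M" "biset N" "m \<in> elems M" "n \<in> elems N"
  shows "lact (M \<otimes>\<^sub>A N) a (tens M N m n) = tens M N (lact M a m) n"
proof -
  have "tensor_lift (\<lambda>m n. tens M N (lact M a m) n) (tens M N m n) = tens M N (lact M a m) n"
    using assms by (intro tensor_lift_tens)
      (auto simp: biset.lact_in tens_balanced simp flip: biset.lact_ract)
  then show ?thesis
    by (simp add: biset_tensor_def)
qed

lemma ract_tens:
  assumes "biset M" "biset N" "m \<in> elems M" "n \<in> elems N"
  shows "ract (M \<otimes>\<^sub>A N) (tens M N m n) a = tens M N m (ract N n a)"
proof -
  have "tensor_lift (\<lambda>m n. tens M N m (ract N n a)) (tens M N m n) = tens M N m (ract N n a)"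
    using assms by (intro tensor_lift_tens) (auto simp: biset.ract_in tens_balanced biset.lact_ract)
  then show ?thesis
    by (simp add: biset_tensor_def)
qed

lemma biset_biset_tensor:
  assumes "biset M" "biset N"
  shows "biset (M \<otimes>\<^sub>A N)"
proof -
  interpret M: biset M by fact
  interpret N: biset N by fact
  show ?thesis
    by unfold_locales
      (auto elim!: tens_cases simp: assms lact_tens ract_tens tens_in_elems M.lact_in M.lact_one
        M.lact_mult N.ract_in N.ract_one N.ract_mult)
qed

lemma biset_biset_unit: "biset biset_unit"
  by unfold_locales (simp_all add: biset_unit_def mult.assoc)

lemma elems_biset_unit: "elems biset_unit = UNIV"
  by (simp add: biset_unit_def)

lemma biset_tensor_map_tens:
  assumes "biset M'" "biset N'" "f \<in> biset_hom M M'" "g \<in> biset_hom N N'"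
    and "m \<in> elems M" "n \<in> elems N"
  shows "biset_tensor_map M M' N N' f g (tens M N m n) = tens M' N' (f m) (g n)"
proof -
  have "tensor_lift (\<lambda>m n. tens M' N' (f m) (g n)) (tens M N m n) = tens M' N' (f m) (g n)"
    using assms by (intro tensor_lift_tens) (simp_all add: assms(3,4)[THEN biset_hom_in] assms(3)[THEN biset_hom_ract]
        assms(4)[THEN biset_hom_lact] tens_balanced)
  then show ?thesis
    using assms by (simp add: biset_tensor_map_def tens_in_elems)
qed

text \<open>The two nested lifts are evaluated from the inside out. Balancedness of the outer one is
  checked on pure tensors, to which \<open>tens_cases\<close> reduces every element of
  \<open>M \<otimes>\<^sub>A N\<close>.\<close>

lemma biset_assoc_tens:
  assumes "biset M" "biset N" "biset P" and m: "m \<in> elems M" and n: "n \<in> elems N" and p: "p \<in> elems P"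
  shows "biset_assoc M N P (tens (M \<otimes>\<^sub>A N) P (tens M N m n) p) = tens M (N \<otimes>\<^sub>A P) m (tens N P n p)"
proof -
  interpret M: biset M by fact
  interpret N: biset N by fact
  interpret P: biset P by fact
  note bisets = assms(1-3) biset_biset_tensor
  have inner: "tensor_lift (\<lambda>m n. tens M (N \<otimes>\<^sub>A P) m (tens N P n p)) (tens M N m n)
      = tens M (N \<otimes>\<^sub>A P) m (tens N P n p)"
    if "m \<in> elems M" "n \<in> elems N" "p \<in> elems P" for m n p
    using that by (intro tensor_lift_tens) (simp_all add: tens_balanced bisets tens_in_elems lact_tens)
  have "tensor_lift (\<lambda>w p. tensor_lift (\<lambda>m n. tens M (N \<otimes>\<^sub>A P) m (tens N P n p)) w)
      (tens (M \<otimes>\<^sub>A N) P (tens M N m n) p)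
    = tensor_lift (\<lambda>m n. tens M (N \<otimes>\<^sub>A P) m (tens N P n p)) (tens M N m n)"
    using m n p by (intro tensor_lift_tens)
      (auto elim!: tens_cases
        simp: bisets ract_tens inner P.lact_in N.ract_in tens_balanced tens_in_elems)
  with m n p show ?thesis
    by (simp add: biset_assoc_def inner tens_in_elems)
qed

lemma biset_lunit_tens:
  assumes "biset M" "m \<in> elems M"
  shows "biset_lunit M (tens biset_unit M a m) = lact M a m"
proof -
  have "tensor_lift (lact M) (tens biset_unit M a m) = lact M a m"
    using assms by (intro tensor_lift_tens) (simp_all add: biset_unit_def biset.lact_mult)
  then show ?thesis
    using assms by (simp add: biset_lunit_def tens_in_elems elems_biset_unit)
qed

lemma biset_runit_tens:
  assumes "biset M" "m \<in> elems M"
  shows "biset_runit M (tens M biset_unit m a) = ract M m a"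
proof -
  have "tensor_lift (ract M) (tens M biset_unit m a) = ract M m a"
    using assms by (intro tensor_lift_tens) (simp_all add: biset_unit_def biset.ract_mult)
  then show ?thesis
    using assms by (simp add: biset_runit_def tens_in_elems elems_biset_unit)
qed

section \<open>Isomorphisms and the category of bisets\<close>

lemma biset_isoI:
  assumes "biset M" and f: "f \<in> biset_hom M N" and bij: "bij_betw f (elems M) (elems N)"
  shows "f \<in> biset_iso M N"
proof -
  interpret M: biset M by fact
  define g where "g = restrict (inv_into (elems M) f) (elems N)"
  have gf: "g (f m) = m" if "m \<in> elems M" for m
    using that bij by (simp add: g_def bij_betw_inv_into_left bij_betw_apply)
  have fg: "f (g n) = n" and g_in: "g n \<in> elems M" if "n \<in> elems N" for n
    using that bij
    by (auto simp: g_def bij_betw_inv_into_right bij_betw_apply[OF bij_betw_inv_into])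
  have "g \<in> biset_hom N M"
  proof (rule biset_homI)
    fix n a assume n: "n \<in> elems N"
    \<comment> \<open>Equivariance of the inverse: applying \<open>g\<close> to these equations
      cancels \<open>f\<close> on the left.\<close>
    have "f (lact M a (g n)) = lact N a n" "f (ract M (g n) a) = ract N n a"
      using f n by (simp_all add: biset_hom_lact[OF f] biset_hom_ract[OF f] g_in fg)
    then show "g (lact N a n) = lact M a (g n)" "g (ract N n a) = ract M (g n) a"
      using gf[OF M.lact_in[OF g_in[OF n]], of a] gf[OF M.ract_in[OF g_in[OF n]], of a]
      by simp_all
  qed (simp_all only: g_in, simp add: g_def)
  then show ?thesis
    using f gf fg by (auto simp: biset_iso_def)
qed

lemma restrict_id_biset_hom: "(\<lambda>m\<in>elems M. m) \<in> biset_hom M M" if "biset M"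
  using that by (intro biset_homI) (simp_all add: biset.lact_in biset.ract_in)

lemma compose_biset_hom: "compose (elems L) g f \<in> biset_hom L N"
  if "biset L" "f \<in> biset_hom L M" "g \<in> biset_hom M N"
  using that
  by (intro biset_homI) (simp_all add: compose_def biset.lact_in biset.ract_in
      that(2,3)[THEN biset_hom_in] that(2,3)[THEN biset_hom_lact] that(2,3)[THEN biset_hom_ract])

text \<open>The laws are equalities of total functions; off the carrier both sides are
  \<open>undefined\<close>, by extensionality of the maps.\<close>

lemma category_biset_category:
  "category (biset_category :: (('a::monoid_mult, 'e) biset, 'e \<Rightarrow> 'e) category)"
proof (unfold_locales, goal_cases)
  case (1 x)
  then show ?case
    by (simp add: biset_category_def restrict_id_biset_hom)
next
  case (2 x y z f g)
  then show ?case
    by (simp add: biset_category_def compose_biset_hom)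
next
  case (3 x y f)
  then have f: "f \<in> biset_hom x y"
    by (simp add: biset_category_def)
  show ?case
    by (auto simp: biset_category_def compose_def fun_eq_iff f[THEN biset_hom_in]
        f[THEN biset_hom_undefined])
next
  case (4 x y f)
  then have f: "f \<in> biset_hom x y"
    by (simp add: biset_category_def)
  show ?case
    by (auto simp: biset_category_def compose_def fun_eq_iff f[THEN biset_hom_undefined])
next
  case (5 w x y z f g h)
  then have f: "f \<in> biset_hom w x"
    by (simp add: biset_category_def)
  show ?case
    by (auto simp: biset_category_def compose_def fun_eq_iff f[THEN biset_hom_in])
qed


section \<open>The module category of a skew monoidal monoid\<close>

text \<open>Lets an equation for a product of two factors also fire inside a longer product that
  \<open>mult.assoc\<close> has nested to the right.\<close>

lemma mult_eq_left_assoc: "a * b = c \<Longrightarrow> a * (b * x) = c * x" for a b c x :: "'a::monoid_mult"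
  by (simp flip: mult.assoc)

context skew_monoidal_monoid
begin

text \<open>A normal form: \<open>\<T>\<close> and \<open>\<Q>\<close> are distributed over
  products, values of \<open>\<Q>\<close> move left past values of \<open>\<T>\<close>, and
  \<open>\<gamma>\<close> moves right.\<close>

lemmas commute_rules = mult.assoc T_one T_mult Q_one Q_mult
  T_Q_commute T_Q_commute[THEN mult_eq_left_assoc]
  gam_TT gam_TT[THEN mult_eq_left_assoc]
  gam_TQ gam_TQ[THEN mult_eq_left_assoc]
  gam_Q gam_Q[THEN mult_eq_left_assoc]

section \<open>Monad identities for \<open>\<mu>\<close> and comonad identities for
  \<open>\<delta>\<close>\<close>

lemma Q_eps_Q: "\<Q> \<epsilon> * \<Q> (\<Q> a) = \<Q> a * \<Q> \<epsilon>"
  by (simp flip: Q_mult eps_Q)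

lemma mu_eta: "\<mu> * \<eta> = 1"
  by (simp add: mu_def mult.assoc gam_eta eps_eta Q_one flip: Q_mult)

lemma mu_T_eta: "\<mu> * \<T> \<eta> = 1"
  by (simp add: mu_def eps_gam_eta)

lemma mu_TT: "\<mu> * \<T> (\<T> a) = \<T> a * \<mu>"
  by (simp add: mu_def commute_rules)

lemma mu_Q: "\<mu> * \<Q> a = \<Q> a * \<mu>"
  by (simp add: mu_def commute_rules Q_eps_Q[THEN mult_eq_left_assoc])

lemma mu_TQ: "\<mu> * \<T> (\<Q> a) = \<Q> (\<epsilon> * \<T> a) * \<gamma>"
  by (simp add: mu_def commute_rules)

text \<open>\<open>eps_Q\<close> at \<open>\<epsilon>\<close> itself replaces
  \<open>\<epsilon> * \<Q> \<epsilon>\<close> by \<open>\<epsilon> * \<epsilon>\<close>. This is the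
  module law for the unit object.\<close>

lemma eps_mu: "\<epsilon> * \<mu> = \<epsilon> * \<T> \<epsilon>"
proof -
  have "\<epsilon> * \<mu> = (\<epsilon> * \<Q> \<epsilon>) * \<gamma>"
    by (simp add: mu_def mult.assoc)
  also have "\<dots> = \<epsilon> * (\<epsilon> * \<gamma>)"
    by (simp add: mult.assoc flip: eps_Q)
  finally show ?thesis
    by (simp add: eps_gam)
qed

lemma gam_T_gam: "\<Q> \<gamma> * (\<gamma> * \<T> \<gamma>) = \<gamma> * \<gamma>"
  using gam_gam by (simp add: mult.assoc power2_eq_square)

text \<open>Collecting the factors under \<open>\<Q>\<close> produces
  \<open>\<epsilon> * \<T> \<epsilon>\<close>, which \<open>eps_mu\<close> turns into
  \<open>\<epsilon> * \<mu>\<close>; the pentagon law \<open>gam_gam\<close> then applies.\<close>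

lemma mu_T_mu: "\<mu> * \<T> \<mu> = \<mu> * \<mu>"
proof -
  have "\<mu> * \<T> \<mu> = \<Q> (\<epsilon> * \<T> \<epsilon>) * \<gamma> * \<T> \<gamma>"
    by (simp add: mu_def commute_rules)
  also have "\<dots> = \<Q> \<epsilon> * \<Q> \<mu> * \<gamma> * \<T> \<gamma>"
    by (simp flip: eps_mu Q_mult)
  also have "\<dots> = \<Q> \<epsilon> * \<Q> (\<Q> \<epsilon>) * (\<gamma> * \<gamma>)"
    by (simp add: mu_def commute_rules gam_T_gam)
  also have "\<dots> = \<mu> * \<mu>"
    by (simp add: mu_def commute_rules)
  finally show ?thesis .
qed

text \<open>The pentagon law splits \<open>\<gamma> * \<gamma>\<close> so that
  \<open>\<epsilon> * \<gamma>\<close> and \<open>\<gamma> * \<eta>\<close> appear; what they leave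
  behind cancels by \<open>eps_eta\<close>.\<close>

lemma mu_delta: "\<mu> * \<delta> = \<gamma>"
proof -
  have "\<mu> * \<delta> = \<Q> \<epsilon> * (\<gamma> * \<gamma>) * \<T> \<eta>"
    by (simp add: mu_def delta_def mult.assoc)
  also have "\<dots> = \<Q> (\<epsilon> * \<gamma>) * \<gamma> * \<T> (\<gamma> * \<eta>)"
    by (simp add: commute_rules flip: gam_T_gam)
  also have "\<dots> = \<Q> (\<T> (\<epsilon> * \<eta>)) * \<gamma>"
    by (simp add: eps_gam gam_eta commute_rules)
  finally show ?thesis
    by (simp add: eps_eta commute_rules)
qed

lemma delta_T: "\<delta> * \<T> a = \<T> a * \<delta>"
proof -
  have "\<delta> * \<T> a = \<gamma> * \<T> (\<eta> * a)"
    by (simp add: delta_def commute_rules)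
  then show ?thesis
    by (subst (asm) eta_T) (simp add: delta_def commute_rules)
qed

lemma delta_Q: "\<delta> * \<Q> a = \<Q> (\<Q> a) * \<delta>"
  by (simp add: delta_def commute_rules)

lemma eps_delta: "\<epsilon> * \<delta> = 1"
  by (simp add: delta_def eps_gam[THEN mult_eq_left_assoc] eps_eta T_one flip: T_mult)

lemma Q_eps_delta: "\<Q> \<epsilon> * \<delta> = 1"
  using eps_gam_eta by (simp add: delta_def mult.assoc)

lemma delta_eta: "\<delta> * \<eta> = \<Q> \<eta> * \<eta>"
  by (simp add: delta_def mult.assoc gam_eta[THEN mult_eq_left_assoc] flip: eta_T)

text \<open>Coassociativity of the comonad \<open>\<Q>\<close>: the pentagon law again, after
  naturality of \<open>\<eta>\<close> has replaced \<open>\<T> \<eta> * \<eta>\<close> by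
  \<open>\<eta> * \<eta>\<close>.\<close>

lemma delta_delta: "\<delta> * \<delta> = \<Q> \<delta> * \<delta>"
proof -
  have "\<delta> * \<delta> = \<gamma> * (\<gamma> * \<T> (\<T> \<eta> * \<eta>))"
    by (simp add: delta_def commute_rules)
  also have "\<dots> = \<Q> \<gamma> * \<gamma> * \<T> (\<gamma> * \<eta> * \<eta>)"
    by (simp add: commute_rules gam_T_gam[THEN mult_eq_left_assoc, simplified mult.assoc] flip: eta_T gam_T_gam)
  also have "\<dots> = \<Q> \<delta> * \<delta>"
    by (simp add: gam_eta delta_def commute_rules)
  finally show ?thesis .
qed

text \<open>Compatibility of the monad and the comonad. It yields the module law for tensor products
  and makes \<open>\<delta>\<close> an arrow out of \<open>\<mu>\<close>.\<close>

lemma delta_mu: "\<delta> * \<mu> = \<Q> \<mu> * \<gamma> * \<T> \<delta>"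
proof -
  have "\<delta> * \<mu> = \<Q> (\<Q> \<epsilon>) * (\<gamma> * \<gamma>) * \<T> (\<T> \<eta>)"
    by (simp add: mu_def delta_def commute_rules)
  also have "\<dots> = \<Q> \<mu> * \<gamma> * \<T> \<delta>"
    by (simp only: mu_def delta_def commute_rules flip: gam_T_gam)
  finally show ?thesis .
qed


section \<open>Objects, arrows and the strict tensor product\<close>

lemma Obj_iff: "x \<in> Obj (module_category A) \<longleftrightarrow> x * \<mu> = x * \<T> x \<and> x * \<eta> = 1"
  by (simp add: module_category_def)

lemma Hom_iff: "t \<in> Hom (module_category A) x y \<longleftrightarrow> t * x = y * \<T> t"
  by (simp add: module_category_def)

lemma module_category_simps:
  "Ident (module_category A) x = 1"
  "Comp (module_category A) x y z g f = g * f"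
  "tensor_obj (module_category A) x y = y * \<Q> x * \<delta>"
  "tensor_arr (module_category A) x1 y1 x2 y2 s t = y2 * \<Q> s * \<eta> * t"
  "unit_obj (module_category A) = \<epsilon>"
  by (simp_all add: module_category_def)

lemma Obj_mult_eta: "x * \<eta> = 1" if "x \<in> Obj (module_category A)"
  using that by (simp add: Obj_iff)

lemma Obj_mult_T: "x * \<T> x = x * \<mu>" if "x \<in> Obj (module_category A)"
  using that by (simp add: Obj_iff)

lemma Hom_mult_T: "y * \<T> t = t * x" if "t \<in> Hom (module_category A) x y"
  using that by (simp add: Hom_iff)

lemma Hom_comp: "g * f \<in> Hom (module_category A) x z"
  if "f \<in> Hom (module_category A) x y" "g \<in> Hom (module_category A) y z"
proof -
  have "g * f * x = g * (y * \<T> f)" "g * y * \<T> f = z * \<T> g * \<T> f"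
    using that by (simp_all add: Hom_iff mult.assoc)
  then show ?thesis
    by (simp add: Hom_iff T_mult mult.assoc)
qed

lemma eps_Obj: "\<epsilon> \<in> Obj (module_category A)"
  by (simp add: Obj_iff eps_mu eps_eta)

lemma mu_Obj: "\<mu> \<in> Obj (module_category A)"
  by (simp add: Obj_iff mu_T_mu mu_eta)

text \<open>Moving the last \<open>x\<close> across \<open>\<eta>\<close> and \<open>\<Q> s\<close>
  turns it into \<open>\<T> x\<close>, where the module law gives \<open>x * \<mu>\<close>; then
  \<open>\<mu>\<close> passes \<open>\<Q> s\<close> and cancels \<open>\<eta>\<close>.\<close>

lemma Obj_Q_eta: "x * \<Q> s * \<eta> * x = x * \<Q> s" if x: "x \<in> Obj (module_category A)"
proof -
  have "x * \<Q> s * \<eta> * x = x * \<T> x * \<Q> s * \<eta>"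
    by (simp add: mult.assoc eta_T[of x] T_Q_commute[THEN mult_eq_left_assoc])
  also have "\<dots> = x * \<Q> s * (\<mu> * \<eta>)"
    by (simp add: Obj_mult_T[OF x] mult.assoc mu_Q[THEN mult_eq_left_assoc])
  finally show ?thesis
    by (simp add: mu_eta)
qed

text \<open>Writes a tensor of arrows with its second factor in front, using the source in place of
  the target.\<close>

lemma tensor_arr_eq: "y * \<Q> s * \<eta> * t = t * x * \<Q> s * \<eta>"
  if "t \<in> Hom (module_category A) x y"
proof -
  have "y * \<Q> s * \<eta> * t = y * \<T> t * \<Q> s * \<eta>"
    by (simp add: mult.assoc eta_T[of t] T_Q_commute[THEN mult_eq_left_assoc])
  then show ?thesis
    using that by (simp add: Hom_mult_T)
qed

text \<open>Since \<open>\<delta>\<close> commutes with values of \<open>\<T>\<close>, the factor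
  \<open>\<T> y\<close> reaches \<open>y\<close> and becomes \<open>\<mu>\<close>. This
  \<open>\<mu>\<close> meets \<open>\<delta>\<close>, and the resulting \<open>\<gamma>\<close>
  brings \<open>x\<close> and \<open>\<T> x\<close> together under \<open>\<Q>\<close>.\<close>

lemma tensor_Obj: "y * \<Q> x * \<delta> \<in> Obj (module_category A)"
  if x: "x \<in> Obj (module_category A)" and y: "y \<in> Obj (module_category A)"
proof -
  have "y * \<Q> x * \<delta> * \<T> (y * \<Q> x * \<delta>) = (y * \<T> y) * \<Q> x * (\<T> (\<Q> x) * \<delta>) * \<T> \<delta>"
    by (simp add: commute_rules delta_T[THEN mult_eq_left_assoc])
  also have "\<dots> = y * \<Q> x * (\<mu> * \<delta>) * \<T> (\<Q> x) * \<T> \<delta>"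
    by (simp add: Obj_mult_T[OF y] mult.assoc mu_Q[THEN mult_eq_left_assoc] delta_T[THEN mult_eq_left_assoc])
  also have "\<dots> = y * \<Q> (x * \<T> x) * \<gamma> * \<T> \<delta>"
    by (simp add: mu_delta commute_rules)
  also have "\<dots> = y * \<Q> x * (\<delta> * \<mu>)"
    by (simp add: Obj_mult_T[OF x] delta_mu Q_mult mult.assoc)
  finally have "y * \<Q> x * \<delta> * \<mu> = y * \<Q> x * \<delta> * \<T> (y * \<Q> x * \<delta>)"
    by (simp add: mult.assoc)
  moreover have "y * \<Q> x * \<delta> * \<eta> = y * \<Q> (x * \<eta>) * \<eta>"
    by (simp add: mult.assoc delta_eta Q_mult)
  ultimately show ?thesis
    using x y by (simp add: Obj_iff Q_one)
qed

lemma tensor_Hom: "y2 * \<Q> s * \<eta> * t \<in> Hom (module_category A) (x2 * \<Q> x1 * \<delta>) (y2 * \<Q> y1 * \<delta>)"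
  if x2: "x2 \<in> Obj (module_category A)" and y2: "y2 \<in> Obj (module_category A)"
    and s: "s \<in> Hom (module_category A) x1 y1" and t: "t \<in> Hom (module_category A) x2 y2"
proof -
  have "y2 * \<Q> y1 * \<delta> * \<T> (y2 * \<Q> s * \<eta> * t)
      = (y2 * \<T> y2) * \<Q> y1 * (\<T> (\<Q> s) * \<delta>) * \<T> (\<eta> * t)"
    by (simp add: commute_rules delta_T[THEN mult_eq_left_assoc])
  also have "\<dots> = y2 * \<Q> y1 * (\<mu> * \<delta>) * \<T> (\<Q> s) * \<T> (\<eta> * t)"
    by (simp add: Obj_mult_T[OF y2] mult.assoc mu_Q[THEN mult_eq_left_assoc]
        delta_T[THEN mult_eq_left_assoc])
  also have "\<dots> = y2 * \<Q> (y1 * \<T> s) * \<delta> * \<T> t"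
    by (simp add: mu_delta commute_rules) (simp add: delta_def mult.assoc)
  also have "\<dots> = (y2 * \<T> t) * \<Q> s * \<Q> x1 * \<delta>"
    by (simp add: Hom_mult_T[OF s] delta_T mult.assoc Q_mult T_Q_commute[THEN mult_eq_left_assoc])
  \<comment> \<open>\<open>Obj_Q_eta\<close> read from right to left inserts the missing
    \<open>\<eta> * x2\<close>.\<close>
  also have "\<dots> = t * (x2 * \<Q> s * \<eta> * x2) * \<Q> x1 * \<delta>"
    by (simp only: Hom_mult_T[OF t] Obj_Q_eta[OF x2]) (simp add: mult.assoc)
  also have "\<dots> = y2 * \<Q> s * \<eta> * t * (x2 * \<Q> x1 * \<delta>)"
    by (simp add: tensor_arr_eq[OF t]) (simp add: mult.assoc)
  finally show ?thesis
    by (simp add: Hom_iff)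
qed

text \<open>The interchange law: with \<open>t'\<close> in front, the inner
  \<open>\<eta> * y2\<close> is absorbed by \<open>Obj_Q_eta\<close>, and the two values of
  \<open>\<Q>\<close> merge.\<close>

lemma tensor_Comp:
  "z2 * \<Q> (s' * s) * \<eta> * (t' * t) = (z2 * \<Q> s' * \<eta> * t') * (y2 * \<Q> s * \<eta> * t)"
  if y2: "y2 \<in> Obj (module_category A)" and t': "t' \<in> Hom (module_category A) y2 z2"
proof -
  have "(z2 * \<Q> s' * \<eta> * t') * (y2 * \<Q> s * \<eta> * t) = t' * (y2 * \<Q> s' * \<eta> * y2) * \<Q> s * \<eta> * t"
    by (simp add: tensor_arr_eq[OF t']) (simp add: mult.assoc)
  also have "\<dots> = t' * y2 * \<Q> (s' * s) * \<eta> * t"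
    by (simp add: Obj_Q_eta[OF y2]) (simp add: mult.assoc Q_mult)
  finally show ?thesis
    by (simp add: tensor_arr_eq[OF t', symmetric] flip: mult.assoc)
qed

lemma strict_monoidal_module_category: "strict_monoidal_category (module_category A)"
proof (unfold_locales, goal_cases)
  \<comment> \<open>Associativity on objects is coassociativity of \<open>\<delta>\<close>.\<close>
  case (11 x y z)
  show ?case
    by (simp add: module_category_simps mult.assoc Q_mult delta_Q[THEN mult_eq_left_assoc] delta_delta)
next
  case (13 x)
  show ?case
    by (simp add: module_category_simps mult.assoc eps_delta eps_Q[symmetric, THEN mult_eq_left_assoc])
next
  \<comment> \<open>The two bracketings of three arrows differ by a factor
    \<open>\<eta> * y3\<close>, which \<open>Obj_Q_eta\<close> absorbs.\<close>
  case (14 x1 y1 x2 y2 x3 y3 s t u)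
  have "y3 * \<Q> y2 * \<delta> * \<Q> s * \<eta> * (y3 * \<Q> t * \<eta> * u)
      = y3 * \<Q> (y2 * \<Q> s * \<eta>) * \<eta> * y3 * \<Q> t * \<eta> * u"
    by (simp add: mult.assoc Q_mult delta_Q[THEN mult_eq_left_assoc] delta_eta[THEN mult_eq_left_assoc])
  also have "\<dots> = y3 * \<Q> (y2 * \<Q> s * \<eta>) * \<Q> t * \<eta> * u"
    using 14 by (simp add: Obj_Q_eta)
  finally show ?case
    by (simp add: module_category_simps Q_mult mult.assoc)
next
  case (16 x y t)
  show ?case
    by (simp add: module_category_simps eps_eta mult.assoc[of t] flip: eps_Q)
qed (simp_all add: module_category_simps Hom_iff[of 1] Hom_comp T_one Q_one eps_Obj tensor_Obj tensor_Hom
      tensor_Comp Obj_mult_eta, simp_all add: mult.assoc Q_eps_delta)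

lemma Q_mult_assoc: "\<Q> a * (\<Q> b * c) = \<Q> (a * b) * c"
  by (simp add: Q_mult mult.assoc)

text \<open>Once \<open>\<mu>\<close> has passed the values of \<open>\<Q>\<close> and cancelled
  \<open>\<eta>\<close>, coassociativity is \<open>delta_delta\<close>, and the counit laws are
  \<open>Q_eps_delta\<close> and \<open>eps_delta\<close>.\<close>

lemma comonoid_mu: "comonoid (module_category A) \<mu> \<epsilon> \<delta>"
proof -
  interpret strict_monoidal_category "module_category A"
    by (rule strict_monoidal_module_category)
  show ?thesis
  proof (unfold_locales, goal_cases)
    case 3
    show ?case
      by (simp add: module_category_simps Hom_iff delta_mu mult.assoc mu_Q[THEN mult_eq_left_assoc]
          mu_delta[THEN mult_eq_left_assoc])
  next
    case 4
    show ?case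
      by (simp add: module_category_simps mult.assoc mu_Q[THEN mult_eq_left_assoc] Q_one
          mu_eta[THEN mult_eq_left_assoc] mu_eta delta_eta[THEN mult_eq_left_assoc] delta_delta
          Q_mult_assoc)
  qed (simp_all add: module_category_simps mu_Obj Hom_iff eps_mu mult.assoc
      mu_Q[THEN mult_eq_left_assoc] mu_eta[THEN mult_eq_left_assoc] Q_one Q_eps_delta
      eps_eta[THEN mult_eq_left_assoc] eps_delta)
qed

section \<open>Arrows out of \<open>\<mu>\<close>\<close>

lemma Obj_Hom_mu: "x \<in> Hom (module_category A) \<mu> x" if "x \<in> Obj (module_category A)"
  using that by (simp add: Hom_iff Obj_iff)

lemma T_Hom_mu: "\<T> a \<in> Hom (module_category A) \<mu> \<mu>"
  by (simp add: Hom_iff mu_TT)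

lemma Obj_T_Hom: "x * \<T> a \<in> Hom (module_category A) \<mu> x" if "x \<in> Obj (module_category A)"
  using that by (rule Hom_comp[OF T_Hom_mu Obj_Hom_mu])

text \<open>Together with \<open>Hom_mu_eq\<close> this makes \<open>t * \<eta>\<close> the
  coordinate of \<open>t\<close> with respect to the generator \<open>x\<close> of the free right
  \<open>A\<close>-set of arrows from \<open>\<mu>\<close> to \<open>x\<close>.\<close>

lemma Obj_T_eta: "x * \<T> a * \<eta> = a" if "x \<in> Obj (module_category A)"
proof -
  have "x * \<T> a * \<eta> = x * \<eta> * a"
    by (simp add: mult.assoc eta_T)
  with that show ?thesis
    by (simp add: Obj_mult_eta)
qed

lemma Hom_mu_eq: "x * \<T> (t * \<eta>) = t" if "t \<in> Hom (module_category A) \<mu> x"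
proof -
  have "x * \<T> (t * \<eta>) = t * (\<mu> * \<T> \<eta>)"
    by (simp add: T_mult Hom_mult_T[OF that] flip: mult.assoc)
  then show ?thesis
    by (simp add: mu_T_eta)
qed

lemma Hom_mu_eq_range: "Hom (module_category A) \<mu> x = range (\<lambda>a. x * \<T> a)"
  if "x \<in> Obj (module_category A)"
  by (metis (no_types, lifting) Hom_mu_eq Obj_T_Hom[OF that] image_subsetI rangeI subsetI subset_antisym)

section \<open>The antimultiplicative map \<open>\<S>\<close>\<close>

lemma skew_S_Hom_mu: "\<S> a \<in> Hom (module_category A) \<mu> \<mu>"
  unfolding skew_S_def using mu_Obj by (rule Obj_T_Hom)

lemma skew_S_one: "\<S> 1 = 1"
  by (simp add: skew_S_def Q_one mu_T_eta)

lemma skew_S_eta: "\<S> a * \<eta> = \<Q> a * \<eta>"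
  unfolding skew_S_def using mu_Obj by (rule Obj_T_eta)

lemma skew_S_Q: "\<S> a * \<Q> b = \<Q> b * \<S> a"
  by (simp add: skew_S_def commute_rules mu_Q[THEN mult_eq_left_assoc])

text \<open>Both sides are endomorphisms of \<open>\<mu>\<close>, so it suffices to compare their
  products with \<open>\<eta>\<close>.\<close>

lemma skew_S_mult: "\<S> (a * b) = \<S> b * \<S> a"
proof -
  have "\<S> b * \<S> a = \<mu> * \<T> (\<S> b * \<S> a * \<eta>)"
    using Hom_comp[OF skew_S_Hom_mu skew_S_Hom_mu] by (simp add: Hom_mu_eq)
  also have "\<S> b * \<S> a * \<eta> = \<Q> a * (\<S> b * \<eta>)"
    by (simp add: mult.assoc skew_S_eta skew_S_Q[THEN mult_eq_left_assoc])
  also have "\<dots> = \<Q> (a * b) * \<eta>"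
    by (simp add: skew_S_eta Q_mult mult.assoc)
  finally show ?thesis
    by (simp add: skew_S_def)
qed

lemma skew_S_T: "\<S> a * \<T> b = \<T> b * \<S> a"
proof -
  have "\<S> a * \<T> b = \<mu> * \<T> (\<Q> a * (\<eta> * b))"
    by (simp add: skew_S_def commute_rules)
  also have "\<dots> = \<mu> * \<T> (\<T> b) * \<T> (\<Q> a * \<eta>)"
    by (subst eta_T) (simp add: mult.assoc T_Q_commute[THEN mult_eq_left_assoc] flip: T_mult)
  finally show ?thesis
    by (simp add: mu_TT skew_S_def mult.assoc)
qed

text \<open>Passing \<open>\<T> (\<Q> a)\<close> through \<open>\<mu>\<close> leaves
  \<open>\<gamma> * \<T> \<eta>\<close>, a second \<open>\<delta>\<close>; coassociativity puts one
  \<open>\<delta>\<close> under \<open>\<Q>\<close>, where \<open>\<epsilon>\<close> cancels it. The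
  identity gives balancedness of the pairing and the left unit coherence.\<close>

lemma skew_S_Q_delta: "\<S> a * \<Q> s * \<delta> = \<Q> (s * \<T> a) * \<delta>"
proof -
  have "\<S> a * \<Q> s * \<delta> = \<Q> s * (\<mu> * \<T> (\<Q> a)) * \<T> \<eta> * \<delta>"
    by (simp add: skew_S_Q) (simp add: skew_S_def T_mult mult.assoc)
  also have "\<dots> = \<Q> s * \<Q> (\<epsilon> * \<T> a) * (\<delta> * \<delta>)"
    by (simp add: mu_TQ) (simp add: delta_def mult.assoc)
  also have "\<dots> = \<Q> s * \<Q> (\<epsilon> * (\<T> a * \<delta>)) * \<delta>"
    by (simp add: delta_delta Q_mult mult.assoc)
  also have "\<epsilon> * (\<T> a * \<delta>) = \<T> a"
    by (simp add: delta_T[symmetric] eps_delta[THEN mult_eq_left_assoc])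
  finally show ?thesis
    by (simp add: Q_mult)
qed

text \<open>Makes the pairing respect the left actions; the main input is
  \<open>delta_mu\<close>.\<close>

lemma delta_skew_S: "\<delta> * \<S> a = \<Q> (\<S> a) * \<delta>"
proof -
  have "\<delta> * \<S> a = \<Q> \<mu> * \<gamma> * \<T> (\<delta> * (\<Q> a * \<eta>))"
    by (simp add: skew_S_def delta_mu[THEN mult_eq_left_assoc] mult.assoc T_mult)
  also have "\<delta> * (\<Q> a * \<eta>) = \<Q> (\<Q> a * \<eta>) * \<eta>"
    by (simp add: delta_Q[THEN mult_eq_left_assoc] delta_eta Q_mult mult.assoc)
  finally show ?thesis
    by (simp add: skew_S_def delta_def commute_rules)
qed

text \<open>The two actions agree on the generator \<open>\<epsilon>\<close>, as they do on
  \<open>1\<close> in the unit biset.\<close>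

lemma eps_skew_S: "\<epsilon> * \<S> a = \<epsilon> * \<T> a"
proof -
  have "\<epsilon> * \<S> a = \<epsilon> * \<T> (\<epsilon> * \<Q> a * \<eta>)"
    by (simp add: skew_S_def eps_mu[THEN mult_eq_left_assoc] mult.assoc T_mult)
  then show ?thesis
    by (simp add: mult.assoc eps_eta flip: eps_Q)
qed

section \<open>The representable functor to bisets\<close>

lemma hom_biset_simps:
  "elems (hom_biset A x) = Hom (module_category A) \<mu> x"
  "lact (hom_biset A x) a t = t * \<S> a"
  "ract (hom_biset A x) t a = t * \<T> a"
  by (simp_all add: hom_biset_def)

lemma biset_hom_biset: "biset (hom_biset A x)"
  by unfold_locales
    (auto simp: hom_biset_simps skew_S_one skew_S_mult T_one T_mult skew_S_T mult.assoc
      intro: Hom_comp[OF T_Hom_mu] Hom_comp[OF skew_S_Hom_mu])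

lemma hom_map_apply:
  "hom_map A x y t s = t * s" if "s \<in> Hom (module_category A) \<mu> x"
  using that by (simp add: hom_map_def module_category_simps)

lemma hom_map_biset_hom: "hom_map A x y t \<in> biset_hom (hom_biset A x) (hom_biset A y)"
  if "t \<in> Hom (module_category A) x y"
proof (rule biset_homI)
  show "hom_map A x y t s = undefined" if "s \<notin> elems (hom_biset A x)" for s
    using that by (simp add: hom_map_def hom_biset_simps)
qed (use that in \<open>simp_all add: hom_biset_simps hom_map_apply Hom_comp Hom_comp[OF T_Hom_mu]
    Hom_comp[OF skew_S_Hom_mu] mult.assoc\<close>)

lemma faithful_hom_functor:
  "faithful_functor (module_category A) biset_category (hom_biset A) (hom_map A)"
proof -
  interpret strict_monoidal_category "module_category A"
    by (rule strict_monoidal_module_category)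
  interpret biset: category "biset_category :: (('a, 'a) biset, 'a \<Rightarrow> 'a) category"
    by (rule category_biset_category)
  show ?thesis
  proof (unfold_locales, goal_cases)
    case (1 x)
    show ?case
      by (simp add: biset_category_def biset_hom_biset)
  next
    case (2 x y f)
    then show ?case
      by (simp add: biset_category_def hom_map_biset_hom)
  next
    case (3 x)
    show ?case
      by (rule ext) (simp add: biset_category_def hom_map_def module_category_simps hom_biset_simps)
  next
    case (4 x y z f g)
    then show ?case
      by (auto simp: biset_category_def hom_map_def module_category_simps hom_biset_simps
          compose_def fun_eq_iff mult.assoc Hom_comp)
  next
    case (5 x y)
    show ?case
    proof (rule inj_onI)
      fix f g
      assume "hom_map A x y f = hom_map A x y g"
      \<comment> \<open>The object \<open>x\<close> is itself an arrow from \<open>\<mu>\<close> to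
        \<open>x\<close>; comparing the two maps there suffices, because
        \<open>x * \<eta> = 1\<close>.\<close>
      then have "f * x = g * x"
        by (metis hom_map_apply Obj_Hom_mu[OF 5(1)])
      then have "f * (x * \<eta>) = g * (x * \<eta>)"
        by (simp flip: mult.assoc)
      then show "f = g"
        by (simp add: Obj_mult_eta[OF 5(1)])
    qed
  qed
qed

section \<open>The strong monoidal structure\<close>

lemma comonoid_pairing_eq: "comonoid_pairing A x y s t = t * \<Q> s * \<delta>"
  if "t \<in> Hom (module_category A) \<mu> y"
proof -
  have "comonoid_pairing A x y s t = t * (\<mu> * \<Q> s) * \<eta> * \<delta>"
    by (simp add: comonoid_pairing_def Let_def module_category_simps tensor_arr_eq[OF that])
      (simp add: mult.assoc)
  also have "\<dots> = t * \<Q> s * \<delta>"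
    by (simp add: mu_Q mu_eta[THEN mult_eq_left_assoc] mult.assoc)
  finally show ?thesis .
qed

text \<open>The element is the composite of the arrows \<open>\<delta>\<close> and the tensor of
  \<open>s\<close> and \<open>t\<close>.\<close>

lemma comonoid_pairing_Hom:
  "t * \<Q> s * \<delta> \<in> Hom (module_category A) \<mu> (y * \<Q> x * \<delta>)"
  if y: "y \<in> Obj (module_category A)"
    and s: "s \<in> Hom (module_category A) \<mu> x" and t: "t \<in> Hom (module_category A) \<mu> y"
proof -
  have "\<delta> \<in> Hom (module_category A) \<mu> (\<mu> * \<Q> \<mu> * \<delta>)"
    using comonoid.comult_in_Hom[OF comonoid_mu] by (simp add: module_category_simps)
  from Hom_comp[OF this tensor_Hom[OF mu_Obj y s t]] comonoid_pairing_eq[OF t, of x s]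
  show ?thesis
    by (simp add: comonoid_pairing_def Let_def module_category_simps)
qed

lemma hom_tensor_map_tens:
  "hom_tensor_map A x y (tens (hom_biset A x) (hom_biset A y) s t) = t * \<Q> s * \<delta>"
  if s: "s \<in> Hom (module_category A) \<mu> x" and t: "t \<in> Hom (module_category A) \<mu> y"
proof -
  have "tensor_lift (comonoid_pairing A x y) (tens (hom_biset A x) (hom_biset A y) s t)
      = comonoid_pairing A x y s t"
  proof (rule tensor_lift_tens)
    fix m a n
    assume n: "n \<in> elems (hom_biset A y)"
    then have "n * \<S> a \<in> Hom (module_category A) \<mu> y"
      by (simp add: hom_biset_simps Hom_comp[OF skew_S_Hom_mu])
    with n show "comonoid_pairing A x y (ract (hom_biset A x) m a) n
        = comonoid_pairing A x y m (lact (hom_biset A y) a n)"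
      by (simp add: hom_biset_simps comonoid_pairing_eq)
        (simp add: mult.assoc flip: skew_S_Q_delta)
  qed (use s t in \<open>simp_all add: hom_biset_simps\<close>)
  then show ?thesis
    using s t by (simp add: hom_tensor_map_def tens_in_elems hom_biset_simps comonoid_pairing_eq)
qed

text \<open>On pure tensors, left equivariance is \<open>delta_skew_S\<close> and right equivariance
  is \<open>delta_T\<close>.\<close>

lemma hom_tensor_map_biset_hom:
  "hom_tensor_map A x y
    \<in> biset_hom (hom_biset A x \<otimes>\<^sub>A hom_biset A y) (hom_biset A (y * \<Q> x * \<delta>))"
  if "y \<in> Obj (module_category A)"
proof (rule biset_homI)
  show "hom_tensor_map A x y X = undefined"
    if "X \<notin> elems (hom_biset A x \<otimes>\<^sub>A hom_biset A y)" for X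
    using that by (simp add: hom_tensor_map_def)
next
  fix X a assume "X \<in> elems (hom_biset A x \<otimes>\<^sub>A hom_biset A y)"
  then obtain s t where X: "X = tens (hom_biset A x) (hom_biset A y) s t"
    and s: "s \<in> Hom (module_category A) \<mu> x" and t: "t \<in> Hom (module_category A) \<mu> y"
    by (auto elim!: tens_cases simp: hom_biset_simps)
  show "hom_tensor_map A x y X \<in> elems (hom_biset A (y * \<Q> x * \<delta>))"
    using that s t by (simp add: X hom_tensor_map_tens hom_biset_simps comonoid_pairing_Hom)
  show "hom_tensor_map A x y (lact (hom_biset A x \<otimes>\<^sub>A hom_biset A y) a X)
      = lact (hom_biset A (y * \<Q> x * \<delta>)) a (hom_tensor_map A x y X)"
    using s t by (simp add: X lact_tens biset_hom_biset hom_biset_simps hom_tensor_map_tens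
        Hom_comp[OF skew_S_Hom_mu] mult.assoc delta_skew_S Q_mult)
  show "hom_tensor_map A x y (ract (hom_biset A x \<otimes>\<^sub>A hom_biset A y) X a)
      = ract (hom_biset A (y * \<Q> x * \<delta>)) (hom_tensor_map A x y X) a"
    using s t by (simp add: X ract_tens biset_hom_biset hom_biset_simps hom_tensor_map_tens
        Hom_comp[OF T_Hom_mu] mult.assoc delta_T T_Q_commute[THEN mult_eq_left_assoc])
qed

lemma hom_tensor_map_bij:
  "bij_betw (hom_tensor_map A x y) (elems (hom_biset A x \<otimes>\<^sub>A hom_biset A y))
    (elems (hom_biset A (y * \<Q> x * \<delta>)))"
  if x: "x \<in> Obj (module_category A)" and y: "y \<in> Obj (module_category A)"
proof -
  let ?M = "hom_biset A x" and ?N = "hom_biset A y"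
  have eq: "hom_tensor_map A x y (tens ?M ?N x (y * \<T> a)) = y * \<Q> x * \<delta> * \<T> a" for a
    using x y by (simp add: hom_tensor_map_tens Obj_Hom_mu Obj_T_Hom)
      (simp add: mult.assoc delta_T T_Q_commute[THEN mult_eq_left_assoc])
  show ?thesis
  proof (rule bij_betw_byWitness[where f' = "\<lambda>u. tens ?M ?N x (y * \<T> (u * \<eta>))"])
    show "\<forall>X\<in>elems (?M \<otimes>\<^sub>A ?N). tens ?M ?N x (y * \<T> (hom_tensor_map A x y X * \<eta>)) = X"
    proof
      fix X assume "X \<in> elems (?M \<otimes>\<^sub>A ?N)"
      then obtain s t where X: "X = tens ?M ?N s t"
        and s: "s \<in> Hom (module_category A) \<mu> x" and t: "t \<in> Hom (module_category A) \<mu> y"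
        by (auto elim!: tens_cases simp: hom_biset_simps)
      \<comment> \<open>Writing \<open>s = x * \<T> (s * \<eta>)\<close> and moving the coordinate
        \<open>s * \<eta>\<close> across the tensor brings every class to the form with first entry
        \<open>x\<close>; \<open>b\<close> is the coordinate of the second entry.\<close>
      define b where "b = t * \<S> (s * \<eta>) * \<eta>"
      have "y * \<T> b = t * \<S> (s * \<eta>)"
        unfolding b_def by (rule Hom_mu_eq[OF Hom_comp[OF skew_S_Hom_mu t]])
      moreover have "tens ?M ?N (x * \<T> (s * \<eta>)) t = tens ?M ?N x (t * \<S> (s * \<eta>))"
        using tens_balanced[of ?M ?N x t "s * \<eta>"] x t
        by (simp add: biset_hom_biset hom_biset_simps Obj_Hom_mu)
      ultimately have "X = tens ?M ?N x (y * \<T> b)"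
        by (simp add: X Hom_mu_eq[OF s])
      then show "tens ?M ?N x (y * \<T> (hom_tensor_map A x y X * \<eta>)) = X"
        by (simp add: eq Obj_T_eta[OF tensor_Obj[OF x y]])
    qed
    show "\<forall>u\<in>elems (hom_biset A (y * \<Q> x * \<delta>)).
        hom_tensor_map A x y (tens ?M ?N x (y * \<T> (u * \<eta>))) = u"
      by (simp add: eq Hom_mu_eq hom_biset_simps)
    show "hom_tensor_map A x y ` elems (?M \<otimes>\<^sub>A ?N) \<subseteq> elems (hom_biset A (y * \<Q> x * \<delta>))"
      using biset_hom_in[OF hom_tensor_map_biset_hom[OF y]] by blast
    show "(\<lambda>u. tens ?M ?N x (y * \<T> (u * \<eta>))) ` elems (hom_biset A (y * \<Q> x * \<delta>))
        \<subseteq> elems (?M \<otimes>\<^sub>A ?N)"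
      using x y by (auto intro!: tens_in_elems simp: hom_biset_simps Obj_Hom_mu Obj_T_Hom)
  qed
qed

lemma hom_unit_map_eq: "hom_unit_map A a = \<epsilon> * \<T> a"
  by (simp add: hom_unit_map_def hom_biset_simps)

text \<open>Left equivariance combines \<open>eps_skew_S\<close> with the commutation of
  \<open>\<S>\<close> and \<open>\<T>\<close>; the inverse takes the coordinate
  \<open>t * \<eta>\<close>.\<close>

lemma hom_unit_map_iso: "hom_unit_map A \<in> biset_iso biset_unit (hom_biset A \<epsilon>)"
proof (rule biset_isoI[OF biset_biset_unit])
  show "hom_unit_map A \<in> biset_hom biset_unit (hom_biset A \<epsilon>)"
  proof (rule biset_homI)
    fix m a
    have "\<epsilon> * \<T> m * \<S> a = \<epsilon> * \<S> a * \<T> m"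
      by (simp add: mult.assoc skew_S_T)
    then show "hom_unit_map A (lact biset_unit a m) = lact (hom_biset A \<epsilon>) a (hom_unit_map A m)"
      by (simp add: hom_unit_map_eq biset_unit_def hom_biset_simps eps_skew_S T_mult mult.assoc)
  qed (simp_all add: hom_unit_map_eq biset_unit_def hom_biset_simps T_mult mult.assoc
      Obj_T_Hom eps_Obj)
  show "bij_betw (hom_unit_map A) (elems biset_unit) (elems (hom_biset A \<epsilon>))"
    by (rule bij_betw_byWitness[where f' = "\<lambda>t. t * \<eta>"])
      (auto simp: hom_unit_map_eq hom_biset_simps Obj_T_eta eps_Obj Hom_mu_eq Obj_T_Hom
        biset_unit_def)
qed

text \<open>Each coherence condition is tested on pure tensors, where the structure maps have
  explicit values.\<close>

lemma strong_monoidal_hom_functor: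
  "strong_monoidal_functor (module_category A) (hom_biset A) (hom_map A)
    (hom_tensor_map A) (hom_unit_map A)"
proof -
  interpret strict_monoidal_category "module_category A"
    by (rule strict_monoidal_module_category)
  interpret faithful_functor "module_category A" biset_category "hom_biset A" "hom_map A"
    by (rule faithful_hom_functor)
  note tensor_map_tens = biset_tensor_map_tens[OF biset_hom_biset biset_hom_biset]
  note id_hom = restrict_id_biset_hom[OF biset_hom_biset, unfolded hom_biset_simps]
  note unit_hom = hom_unit_map_iso[unfolded biset_iso_def, THEN CollectD, THEN conjunct1]
  show ?thesis
  proof (unfold_locales, goal_cases)
    case (1 x y)
    then show ?case
      by (simp add: module_category_simps biset_isoI biset_biset_tensor biset_hom_biset
          hom_tensor_map_biset_hom hom_tensor_map_bij)
  next
    case 2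
    show ?case
      by (simp add: module_category_simps hom_unit_map_iso)
  next
    case (3 x1 y1 x2 y2 s t)
    show ?case
    proof
      fix X assume "X \<in> elems (hom_biset A x1 \<otimes>\<^sub>A hom_biset A x2)"
      then obtain p q where X: "X = tens (hom_biset A x1) (hom_biset A x2) p q"
        and p: "p \<in> Hom (module_category A) \<mu> x1" and q: "q \<in> Hom (module_category A) \<mu> x2"
        by (auto elim!: tens_cases simp: hom_biset_simps)
      \<comment> \<open>Naturality: moving first \<open>t\<close>, then \<open>q\<close> to the
        front puts \<open>\<mu> * \<Q> s * \<eta>\<close> in the middle, which reduces to
        \<open>\<Q> s\<close>.\<close>
      have "y2 * \<Q> s * \<eta> * t * (q * \<Q> p * \<delta>) = t * (x2 * \<Q> s * \<eta> * q) * \<Q> p * \<delta>"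
        by (simp add: tensor_arr_eq[OF 3(6), symmetric] flip: mult.assoc)
      also have "\<dots> = t * q * \<Q> (s * p) * \<delta>"
        by (simp add: tensor_arr_eq[OF q])
          (simp add: mult.assoc Q_mult mu_Q[THEN mult_eq_left_assoc] mu_eta[THEN mult_eq_left_assoc])
      finally show "hom_map A (tensor_obj (module_category A) x1 x2)
          (tensor_obj (module_category A) y1 y2)
          (tensor_arr (module_category A) x1 y1 x2 y2 s t) (hom_tensor_map A x1 x2 X)
        = hom_tensor_map A y1 y2 (biset_tensor_map (hom_biset A x1) (hom_biset A y1)
            (hom_biset A x2) (hom_biset A y2) (hom_map A x1 y1 s) (hom_map A x2 y2 t) X)"
        using 3 p q
        by (simp add: X tensor_map_tens hom_map_biset_hom hom_biset_simps hom_tensor_map_tens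
            hom_map_apply module_category_simps comonoid_pairing_Hom Hom_comp)
    qed
  next
    case (4 x y z)
    let ?M = "hom_biset A x" and ?N = "hom_biset A y" and ?P = "hom_biset A z"
    show ?case
    proof
      fix X assume "X \<in> elems ((?M \<otimes>\<^sub>A ?N) \<otimes>\<^sub>A ?P)"
      then obtain s t u where X: "X = tens (?M \<otimes>\<^sub>A ?N) ?P (tens ?M ?N s t) u"
        and s: "s \<in> Hom (module_category A) \<mu> x" and t: "t \<in> Hom (module_category A) \<mu> y"
        and u: "u \<in> Hom (module_category A) \<mu> z"
        by (auto elim!: tens_cases simp: hom_biset_simps)
      \<comment> \<open>The associativity hexagon comes down to coassociativity of
        \<open>\<delta>\<close>.\<close>
      have "u * \<Q> (t * \<Q> s * \<delta>) * \<delta> = u * \<Q> t * \<delta> * \<Q> s * \<delta>"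
        by (simp add: Q_mult mult.assoc delta_Q[THEN mult_eq_left_assoc] delta_delta)
      with 4 s t u show "hom_tensor_map A (tensor_obj (module_category A) x y) z
          (biset_tensor_map (?M \<otimes>\<^sub>A ?N) (hom_biset A (tensor_obj (module_category A) x y)) ?P ?P
            (hom_tensor_map A x y) (\<lambda>u\<in>elems ?P. u) X)
        = hom_tensor_map A x (tensor_obj (module_category A) y z)
            (biset_tensor_map ?M ?M (?N \<otimes>\<^sub>A ?P) (hom_biset A (tensor_obj (module_category A) y z))
              (\<lambda>u\<in>elems ?M. u) (hom_tensor_map A y z) (biset_assoc ?M ?N ?P X))"
        by (simp add: X biset_assoc_tens biset_hom_biset tensor_map_tens id_hom
            hom_tensor_map_biset_hom tens_in_elems hom_biset_simps hom_tensor_map_tens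
            module_category_simps comonoid_pairing_Hom)
    qed
  next
    case (5 x)
    show ?case
    proof
      fix X assume "X \<in> elems (biset_unit \<otimes>\<^sub>A hom_biset A x)"
      then obtain a t where X: "X = tens biset_unit (hom_biset A x) a t"
        and t: "t \<in> Hom (module_category A) \<mu> x"
        by (auto elim!: tens_cases simp: hom_biset_simps)
      \<comment> \<open>The left unit law is the balancing identity at
        \<open>s = \<epsilon>\<close>, followed by a counit law.\<close>
      have "t * \<Q> (\<epsilon> * \<T> a) * \<delta> = t * (\<S> a * \<Q> \<epsilon> * \<delta>)"
        by (simp only: skew_S_Q_delta mult.assoc[of t])
      then have "t * \<Q> (\<epsilon> * \<T> a) * \<delta> = t * \<S> a"
        by (simp add: mult.assoc Q_eps_delta)
      with t show "hom_tensor_map A (unit_obj (module_category A)) x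
          (biset_tensor_map biset_unit (hom_biset A (unit_obj (module_category A)))
            (hom_biset A x) (hom_biset A x) (hom_unit_map A) (\<lambda>u\<in>elems (hom_biset A x). u) X)
        = biset_lunit (hom_biset A x) X"
        by (simp add: X biset_lunit_tens biset_hom_biset tensor_map_tens id_hom unit_hom
            hom_biset_simps hom_tensor_map_tens module_category_simps elems_biset_unit
            hom_unit_map_eq Obj_T_Hom eps_Obj)
    qed
  next
    case (6 x)
    show ?case
    proof
      fix X assume "X \<in> elems (hom_biset A x \<otimes>\<^sub>A biset_unit)"
      then obtain t a where X: "X = tens (hom_biset A x) biset_unit t a"
        and t: "t \<in> Hom (module_category A) \<mu> x"
        by (auto elim!: tens_cases simp: hom_biset_simps)
      \<comment> \<open>The right unit law: \<open>\<epsilon> * \<Q> t = t * \<epsilon>\<close>,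
        after which \<open>\<epsilon>\<close> cancels \<open>\<delta>\<close>.\<close>
      have "\<epsilon> * \<T> a * \<Q> t * \<delta> = \<epsilon> * \<Q> t * (\<T> a * \<delta>)"
        by (simp add: mult.assoc T_Q_commute[THEN mult_eq_left_assoc])
      also have "\<dots> = t * \<T> a"
        by (simp add: delta_T[symmetric] mult.assoc eps_delta[THEN mult_eq_left_assoc]
            flip: eps_Q)
      finally show "hom_tensor_map A x (unit_obj (module_category A))
          (biset_tensor_map (hom_biset A x) (hom_biset A x) biset_unit
            (hom_biset A (unit_obj (module_category A))) (\<lambda>u\<in>elems (hom_biset A x). u)
            (hom_unit_map A) X)
        = biset_runit (hom_biset A x) X"
        using t
        by (simp add: X biset_runit_tens biset_hom_biset tensor_map_tens id_hom unit_hom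
            hom_biset_simps hom_tensor_map_tens module_category_simps elems_biset_unit
            hom_unit_map_eq Obj_T_Hom eps_Obj)
    qed
  qed
qed

end

theorem proposition2p1:
  fixes A :: "'a::monoid_mult skew_monoid"
  assumes "skew_monoidal_monoid A"
  shows "strict_monoidal_category (module_category A)
    \<and> comonoid (module_category A) \<mu>\<^bsub>A\<^esub> \<epsilon>\<^bsub>A\<^esub> \<delta>\<^bsub>A\<^esub>
    \<and> (\<forall>x \<in> Obj (module_category A).
          Hom (module_category A) \<mu>\<^bsub>A\<^esub> x = range (\<lambda>a. x * \<T>\<^bsub>A\<^esub> a))
    \<and> faithful_functor (module_category A) biset_category (hom_biset A) (hom_map A)
    \<and> strong_monoidal_functor (module_category A) (hom_biset A) (hom_map A)
        (hom_tensor_map A) (hom_unit_map A)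
    \<and> (\<forall>x \<in> Obj (module_category A). \<forall>y \<in> Obj (module_category A).
        \<forall>s \<in> Hom (module_category A) \<mu>\<^bsub>A\<^esub> x. \<forall>t \<in> Hom (module_category A) \<mu>\<^bsub>A\<^esub> y.
          hom_tensor_map A x y (tens (hom_biset A x) (hom_biset A y) s t)
            = comonoid_pairing A x y s t)
    \<and> hom_unit_map A 1 = \<epsilon>\<^bsub>A\<^esub>"
proof -
  interpret skew_monoidal_monoid A
    by (rule assms)
  show ?thesis
    by (simp add: strict_monoidal_module_category comonoid_mu Hom_mu_eq_range faithful_hom_functor
        strong_monoidal_hom_functor hom_tensor_map_tens comonoid_pairing_eq hom_unit_map_eq T_one)
qed

end
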